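(* Let $\lambda\in\mathbb{C}$ and $\mu>0$, let $f \in \mathcal{C}_{\mathcal{AP}}$ have the Taylor expansion $f(z)=z+\sum_{n=2}^\infty a_nz^n$, $z\in\mathbb{D}$, and let \[ F_{\lambda,\mu}(f)=\left|a_3-\lambda a_2^2\right|-\mu|a_2|. \] Then \[ F_{\lambda,\mu}(f) \le \begin{cases} \displaystyle \frac{1}{48} |25 - 27\lambda| - \frac{3\mu}{4}, & \text{if } |25 - 27\lambda| \ge 12 + 36\mu, \\[4mm] \displaystyle \frac{1}{4}, & \text{if } |25 - 27\lambda| < 12 + 36\mu, \end{cases} \] and \[ F_{\lambda,\mu}(f) \ge \begin{cases} \displaystyle \frac{1}{48} |25 - 27\lambda| - \frac{3\mu}{4}, & \text{if } \mu \ge \frac{1}{18} |25 - 27\lambda| + \frac{2}{3}, \\[4mm] \displaystyle -\frac{3\mu}{4} \sqrt{ \frac{12}{|25 - 27\lambda| + 12} }, & \text{if } \mu^2 \le \frac{1}{27} |25 - 27\lambda| + \frac{4}{9}, \\[5mm] \displaystyle -\frac{1}{4} - \frac{27\mu^2}{4 |25 - 27\lambda| + 48}, & \text{otherwise}. \end{cases} \] These bounds are sharp, i.e. in each case (for each pair $(\lambda,\mu)$ in the corresponding range) there is a function $f\in\mathcal{C}_{\mathcal{AP}}$ for which equality holds.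
   Context: Let $\mathbb{D}=\{z\in\mathbb{C}:|z|<1\}$ and let $\mathcal{A}$ be the class of analytic functions $f$ in $\mathbb{D}$ normalized by $f(0)=0$, $f'(0)=1$, so that $f(z)=z+\sum_{n=2}^\infty a_nz^n$. For analytic $f,g$ in $\mathbb{D}$, $f$ is subordinate to $g$, written $f\prec g$, if there is a Schwarz function $\omega$ (analytic in $\mathbb{D}$, $\omega(0)=0$, $|\omega(z)|<1$ for $z\in\mathbb{D}$) with $f(z)=g(\omega(z))$ for all $z\in\mathbb{D}$. The apple-like convex class $\mathcal{C}_{\mathcal{AP}}$ consists of all $f\in\mathcal{A}$ with $1+\frac{zf''(z)}{f'(z)}\prec \psi_{\mathcal{AP}}(z)$ in $\mathbb{D}$, where $\psi_{\mathcal{AP}}(z)=e^{z}\sqrt{1+z}$ (branch of the square root with $\sqrt{1}=1$). The functional $F_{\lambda,\mu}$ is called the generalized Fekete–Szegő functional. *)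

theory Defs
  imports "HOL-Complex_Analysis.Complex_Analysis"
begin

abbreviation unit_disc :: "complex set" where
  "unit_disc \<equiv> ball 0 1"

definition class_A :: "(complex \<Rightarrow> complex) set" where
  "class_A = {f. f holomorphic_on unit_disc \<and> f 0 = 0 \<and> deriv f 0 = 1}"

definition schwarz_function :: "(complex \<Rightarrow> complex) \<Rightarrow> bool" where
  "schwarz_function w \<longleftrightarrow>
     w holomorphic_on unit_disc \<and> w 0 = 0 \<and> (\<forall>z\<in>unit_disc. cmod (w z) < 1)"

definition subordinate :: "(complex \<Rightarrow> complex) \<Rightarrow> (complex \<Rightarrow> complex) \<Rightarrow> bool"
    (infix "\<prec>\<^sub>s" 50) where
  "f \<prec>\<^sub>s g \<longleftrightarrow>
     f holomorphic_on unit_disc \<and> g holomorphic_on unit_disc \<and>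
     (\<exists>w. schwarz_function w \<and> (\<forall>z\<in>unit_disc. f z = g (w z)))"

definition psi_AP :: "complex \<Rightarrow> complex" where
  "psi_AP z = exp z * csqrt (1 + z)"

(* A zero of f' in the disc is a pole of z f''(z) / f'(z). Although x / 0 = 0 makes the
   quotient total, it is then not holomorphic on the disc, so the holomorphy required by
   subordination already forces f' to be zero-free there. *)
definition class_C_AP :: "(complex \<Rightarrow> complex) set" where
  "class_C_AP =
     {f \<in> class_A. (\<lambda>z. 1 + z * deriv (deriv f) z / deriv f z) \<prec>\<^sub>s psi_AP}"

abbreviation taylor_coeff :: "(complex \<Rightarrow> complex) \<Rightarrow> nat \<Rightarrow> complex" where
  "taylor_coeff f n \<equiv> fps_nth (fps_expansion f 0) n"

definition fekete_szego :: "complex \<Rightarrow> real \<Rightarrow> (complex \<Rightarrow> complex) \<Rightarrow> real" where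
  "fekete_szego l \<mu> f =
     cmod (taylor_coeff f 3 - l * (taylor_coeff f 2)\<^sup>2) - \<mu> * cmod (taylor_coeff f 2)"

end

theory Submission
  imports Defs
begin

text \<open>
Let \<open>w(z) = c\<^sub>1 z + c\<^sub>2 z\<^sup>2 + \<dots>\<close> be the Schwarz function
with \<open>1 + z f''(z) / f'(z) = \<psi>(w(z))\<close>. Since
\<open>\<psi>(z) = 1 + 3/2 z + 7/8 z\<^sup>2 + \<dots>\<close>, comparing coefficients gives
\<open>a\<^sub>2 = 3/4 c\<^sub>1\<close> and \<open>a\<^sub>3 = 25/48 c\<^sub>1\<^sup>2 + 1/4 c\<^sub>2\<close>
(\<open>taylor_coeffs_from_schwarz_function\<close>), so the functional is
\<open>\<bar>(25 - 27 \<lambda>)/48 c\<^sub>1\<^sup>2 + c\<^sub>2/4\<bar> - 3\<mu>/4 \<bar>c\<^sub>1\<bar>\<close>.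

The pairs \<open>(c\<^sub>1, c\<^sub>2)\<close> that occur satisfy
\<open>\<bar>c\<^sub>1\<bar> \<le> 1\<close> and \<open>\<bar>c\<^sub>2\<bar> \<le> 1 - \<bar>c\<^sub>1\<bar>\<^sup>2\<close>, by the Schwarz-Pick
inequality for \<open>w(z)/z\<close> (\<open>schwarz_function_coeffs\<close>). The triangle inequality then bounds the
functional, for \<open>x = \<bar>c\<^sub>1\<bar>\<close> and \<open>T = \<bar>25 - 27 \<lambda>\<bar>\<close>, by
\<open>T/48 x\<^sup>2 + (1 - x\<^sup>2)/4 - 3\<mu>/4 x\<close> from above, and from below both by
\<open>T/48 x\<^sup>2 - (1 - x\<^sup>2)/4 - 3\<mu>/4 x\<close> and by \<open>- 3\<mu>/4 x\<close>
(\<open>fekete_szego_bounds\<close>).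

Conversely, a Blaschke product \<open>w(z) = z (x + u z) / (1 + x u z)\<close> with \<open>\<bar>u\<bar> = 1\<close> realises
\<open>c\<^sub>1 = x\<close>, \<open>c\<^sub>2 = u (1 - x\<^sup>2)\<close> with a free choice of the phase \<open>u\<close>, and every
Schwarz function comes from a function of the class, because the differential equation for
\<open>f\<close> can be integrated (\<open>class_C_AP_from_schwarz_function\<close>). Aligning \<open>c\<^sub>2\<close> with
\<open>25 - 27 \<lambda>\<close> attains the upper quadratic for every \<open>x\<close> in \<open>[0, 1]\<close>; opposing it attains the lower
one for every \<open>x\<close> at which \<open>T/48 x\<^sup>2 \<ge> (1 - x\<^sup>2)/4\<close>
(\<open>fekete_szego_bounds_attained\<close>).

What is left is to optimise quadratics over \<open>[0, 1]\<close>. The upper one takes its maximum at an endpoint.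
The lower bound is \<open>- 3\<mu>/4 x\<close> up to the point
\<open>x\<^sub>0 = sqrt (12 / (T + 12))\<close> at which the two moduli cancel, and a convex quadratic with vertex
\<open>v = 18 \<mu> / (T + 12)\<close> from there on; its minimum is at \<open>1\<close>, at \<open>x\<^sub>0\<close> or at \<open>v\<close>,
according to whether \<open>v \<ge> 1\<close>, \<open>v \<le> x\<^sub>0\<close> or \<open>x\<^sub>0 < v < 1\<close>.
These are the three cases of the lower bound.
\<close>

section \<open>Taylor coefficients of Schwarz functions\<close>

lemma cmod_one_minus_cnj_mult_diff:
  "(cmod (1 - cnj a * b))\<^sup>2 - (cmod (b - a))\<^sup>2 = (1 - (cmod a)\<^sup>2) * (1 - (cmod b)\<^sup>2)"
  unfolding cmod_power2 by (simp add: power2_eq_square algebra_simps)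

text \<open>
The derivative at \<open>0\<close> of \<open>g\<close> followed by the disc automorphism that moves \<open>g 0\<close> to \<open>0\<close> is
\<open>g' 0 / (1 - \<bar>g 0\<bar>\<^sup>2)\<close>, to which the Schwarz lemma applies.
\<close>
lemma Schwarz_Pick_deriv_0:
  assumes g: "g holomorphic_on ball 0 1"
    and lt1: "\<And>z. cmod z < 1 \<Longrightarrow> cmod (g z) < 1"
  shows "cmod (deriv g 0) \<le> 1 - (cmod (g 0))\<^sup>2"
proof -
  define a where "a = g 0"
  define k where "k = (\<lambda>z. (g z - a) / (1 - cnj a * g z))"
  have a: "cmod a < 1"
    using lt1[of 0] by (simp add: a_def)
  have nz: "1 - cnj a * g z \<noteq> 0" if "cmod z < 1" for z
  proof
    assume "1 - cnj a * g z = 0"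
    then have "cmod (cnj a * g z) = 1" by simp
    moreover have "cmod (cnj a * g z) < 1"
      using mult_strict_mono'[OF a lt1[OF that]] by (simp add: norm_mult)
    ultimately show False by simp
  qed
  have k: "k holomorphic_on ball 0 1"
    unfolding k_def using nz by (intro holomorphic_intros g) auto
  have k1: "cmod (k z) < 1" if "cmod z < 1" for z
  proof -
    have "(1 - (cmod a)\<^sup>2) * (1 - (cmod (g z))\<^sup>2) > 0"
      using a lt1[OF that] by (intro mult_pos_pos) (auto simp: power_less_one_iff abs_square_less_1)
    then have "(cmod (g z - a))\<^sup>2 < (cmod (1 - cnj a * g z))\<^sup>2"
      using cmod_one_minus_cnj_mult_diff[of a "g z"] by linarith
    then have "cmod (g z - a) < cmod (1 - cnj a * g z)"
      by (rule power2_less_imp_less) simp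
    then show ?thesis
      using nz[OF that] by (simp add: k_def norm_divide)
  qed
  have "cmod (deriv k 0) \<le> 1"
    by (rule Schwarz_Lemma(2)[OF k _ k1, of 0]) (auto simp: k_def a_def)
  moreover have "deriv k 0 = deriv g 0 / (1 - cnj a * a)"
  proof (rule DERIV_imp_deriv)
    have g': "(g has_field_derivative deriv g 0) (at 0)"
      using g by (rule holomorphic_derivI) auto
    have "(k has_field_derivative
            (deriv g 0 * (1 - cnj a * g 0) - (g 0 - a) * (- (cnj a * deriv g 0)))
              / ((1 - cnj a * g 0) * (1 - cnj a * g 0))) (at 0)"
      unfolding k_def using nz[of 0] by (auto intro!: derivative_eq_intros g')
    then show "(k has_field_derivative deriv g 0 / (1 - cnj a * a)) (at 0)"
      using nz[of 0] by (simp add: a_def)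
  qed
  moreover have "1 - cnj a * a = of_real (1 - (cmod a)\<^sup>2)"
    by (simp add: complex_norm_square mult.commute del: of_real_power)
  moreover have pos: "1 - (cmod a)\<^sup>2 > 0"
    using a by (simp add: power_less_one_iff abs_square_less_1)
  ultimately have "cmod (deriv g 0 / of_real (1 - (cmod a)\<^sup>2)) \<le> 1"
    by metis
  then have "cmod (deriv g 0) / (1 - (cmod a)\<^sup>2) \<le> 1"
    using pos by (simp only: norm_divide norm_of_real abs_of_pos)
  then show ?thesis
    using pos by (simp add: a_def)
qed

lemma holomorphic_has_fps_expansion_0:
  assumes "f holomorphic_on unit_disc"
  shows "f has_fps_expansion fps_expansion f 0"
  using assms by (intro has_fps_expansion_fps_expansion[of unit_disc]) auto

text \<open>
Schwarz-Pick for \<open>g(z) = w(z)/z\<close>, whose first two coefficients are those of \<open>w\<close> shifted by one.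
The Schwarz lemma only gives \<open>\<bar>g\<bar> \<le> 1\<close>; if the value \<open>1\<close> is attained, then \<open>w\<close> is a rotation
and its second coefficient vanishes.
\<close>
lemma schwarz_function_coeffs:
  assumes "schwarz_function w"
  defines "W \<equiv> fps_expansion w 0"
  shows "cmod (fps_nth W (Suc 0)) \<le> 1"
    and "cmod (fps_nth W 2) \<le> 1 - (cmod (fps_nth W (Suc 0)))\<^sup>2"
proof -
  have w: "w holomorphic_on ball 0 1" "w 0 = 0"
      "\<And>z. cmod z < 1 \<Longrightarrow> cmod (w z) < 1"
    using assms by (auto simp: schwarz_function_def)
  obtain g where g: "g holomorphic_on ball 0 1"
      and wg: "\<And>z. cmod z < 1 \<Longrightarrow> w z = z * g z" and g0: "deriv w 0 = g 0"
    using Schwarz3[OF w(1,2)] by blast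
  define G where "G = fps_expansion g 0"
  have G: "g has_fps_expansion G"
    unfolding G_def by (rule holomorphic_has_fps_expansion_0[OF g])
  have "\<forall>\<^sub>F z in nhds 0. z \<in> unit_disc"
    by (intro eventually_nhds_in_open) auto
  then have "\<forall>\<^sub>F z in nhds 0. z * g z = w z"
    by eventually_elim (simp add: wg)
  then have "w has_fps_expansion fps_X * G"
    using has_fps_expansion_mult[OF has_fps_expansion_fps_X G]
    by (rule has_fps_expansion_cong[THEN iffD1, OF _ refl])
  then have W: "W = fps_X * G"
    unfolding W_def by (rule fps_expansion_eqI)
  have W1: "fps_nth W (Suc 0) = g 0" and W2: "fps_nth W 2 = deriv g 0"
    by (simp_all add: W G_def fps_expansion_def)
  show "cmod (fps_nth W (Suc 0)) \<le> 1"
    using Schwarz_Lemma(2)[OF w, of 0] by (simp add: W1 g0)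
  show "cmod (fps_nth W 2) \<le> 1 - (cmod (fps_nth W (Suc 0)))\<^sup>2"
  proof (cases "\<forall>z. cmod z < 1 \<longrightarrow> cmod (g z) < 1")
    case True
    then show ?thesis
      unfolding W1 W2 by (intro Schwarz_Pick_deriv_0 g) auto
  next
    case False
    then obtain z where z: "cmod z < 1" "cmod (g z) \<ge> 1" by auto
    have "(\<exists>z. cmod z < 1 \<and> z \<noteq> 0 \<and> cmod (w z) = cmod z) \<or> cmod (deriv w 0) = 1"
    proof (cases "z = 0")
      case True
      then show ?thesis
        using z Schwarz_Lemma(2)[OF w, of 0] by (simp add: g0)
    next
      case False
      moreover have "cmod z * cmod (g z) \<ge> cmod z * 1"
        using z by (intro mult_left_mono) auto
      ultimately have "cmod (w z) = cmod z"
        using z Schwarz_Lemma(1)[OF w, of z] by (simp add: wg norm_mult)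
      then show ?thesis using z False by auto
    qed
    then obtain \<alpha> where \<alpha>: "\<And>z. cmod z < 1 \<Longrightarrow> w z = \<alpha> * z" "cmod \<alpha> = 1"
      using Schwarz_Lemma(3)[OF w, of 0] by auto
    have "\<forall>\<^sub>F z in nhds 0. z \<in> unit_disc"
      by (intro eventually_nhds_in_open) auto
    then have "\<forall>\<^sub>F z in nhds 0. \<alpha> * z = w z"
      by eventually_elim (simp add: \<alpha>)
    moreover have "(\<lambda>z. \<alpha> * z) has_fps_expansion fps_const \<alpha> * fps_X"
      by (intro fps_expansion_intros)
    ultimately have "w has_fps_expansion fps_const \<alpha> * fps_X"
      by (rule has_fps_expansion_cong[THEN iffD1, OF _ refl])
    then have "W = fps_const \<alpha> * fps_X"
      unfolding W_def by (rule fps_expansion_eqI)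
    then show ?thesis
      by (simp add: \<alpha>)
  qed
qed

section \<open>From Schwarz functions to the class and back\<close>

lemma psi_AP_holomorphic: "psi_AP holomorphic_on unit_disc"
proof -
  have "1 + z \<notin> \<real>\<^sub>\<le>\<^sub>0" if "z \<in> unit_disc" for z :: complex
  proof -
    have "\<bar>Re z\<bar> < 1"
      using that abs_Re_le_cmod[of z] by simp
    then show ?thesis
      by (auto simp: complex_nonpos_Reals_iff)
  qed
  then show ?thesis
    unfolding psi_AP_def by (intro holomorphic_intros) auto
qed

text \<open>
The coefficients of \<open>csqrt (1 + z)\<close> are read off from its square, so that no higher derivative of
the root has to be computed.
\<close>
lemma fps_nth_psi_AP:
  defines "P \<equiv> fps_expansion psi_AP 0"
  shows "fps_nth P 0 = 1" "fps_nth P (Suc 0) = 3 / 2" "fps_nth P 2 = 7 / 8"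
proof -
  define S where "S = fps_expansion (\<lambda>z. csqrt (1 + z)) 0"
  have "(\<lambda>z. csqrt (1 + z)) analytic_on {0}"
    by (intro analytic_intros) auto
  then have S: "(\<lambda>z. csqrt (1 + z)) has_fps_expansion S"
    unfolding S_def by (rule analytic_at_imp_has_fps_expansion_0)
  have "(\<lambda>z. csqrt (1 + z) * csqrt (1 + z)) has_fps_expansion S * S"
    by (intro has_fps_expansion_mult S)
  moreover have "(\<lambda>z. csqrt (1 + z) * csqrt (1 + z)) = (\<lambda>z. 1 + z)"
    by (simp flip: power2_eq_square)
  moreover have "(\<lambda>z::complex. 1 + z) has_fps_expansion 1 + fps_X"
    by (intro fps_expansion_intros)
  ultimately have SS: "S * S = 1 + fps_X"
    using fps_expansion_unique_complex by metis
  have S0: "fps_nth S 0 = 1"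
    using has_fps_expansion_imp_0_eq_fps_nth_0[OF S] by simp
  have "fps_nth (S * S) (Suc 0) = 1"
    unfolding SS by simp
  then have S1: "fps_nth S (Suc 0) = 1 / 2"
    by (simp add: fps_mult_nth S0 field_simps)
  have "fps_nth (S * S) 2 = 0"
    unfolding SS by (simp add: fps_X_def)
  then have S2: "fps_nth S 2 = - 1 / 8"
    by (simp add: fps_mult_nth S0 S1 eval_nat_numeral field_simps add_eq_0_iff)
  have "psi_AP has_fps_expansion fps_exp 1 * S"
    unfolding psi_AP_def[abs_def] by (intro fps_expansion_intros S)
  then have "P = fps_exp 1 * S"
    unfolding P_def by (rule fps_expansion_eqI)
  then show "fps_nth P 0 = 1" "fps_nth P (Suc 0) = 3 / 2" "fps_nth P 2 = 7 / 8"
    by (simp_all add: fps_mult_nth eval_nat_numeral S0 S1 S2[unfolded numeral_2_eq_2])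
qed

text \<open>
Clearing the denominator turns the subordination into the identity
\<open>f' \<cdot> (\<psi> \<circ> w) = f' + z f''\<close> of power series, and its coefficients of orders \<open>1\<close> and \<open>2\<close>
determine \<open>a\<^sub>2\<close> and \<open>a\<^sub>3\<close>.
\<close>
lemma taylor_coeffs_from_schwarz_function:
  assumes f: "f \<in> class_A" and w: "schwarz_function w"
    and eq: "\<And>z. z \<in> unit_disc \<Longrightarrow> 1 + z * deriv (deriv f) z / deriv f z = psi_AP (w z)"
  defines "W \<equiv> fps_expansion w 0"
  shows "taylor_coeff f 2 = 3 / 4 * fps_nth W (Suc 0)"
    and "taylor_coeff f 3 = 25 / 48 * (fps_nth W (Suc 0))\<^sup>2 + 1 / 4 * fps_nth W 2"
proof -
  define A where "A = fps_expansion f 0"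
  define P where "P = fps_expansion psi_AP 0"
  have fh: "f holomorphic_on unit_disc" and f0: "deriv f 0 = 1"
    using f by (auto simp: class_A_def)
  have A: "f has_fps_expansion A"
    unfolding A_def by (rule holomorphic_has_fps_expansion_0[OF fh])
  have A1: "fps_nth A (Suc 0) = 1"
    by (simp add: A_def fps_expansion_def f0)
  have wh: "w holomorphic_on unit_disc" and w0: "w 0 = 0"
    using w by (auto simp: schwarz_function_def)
  have W: "w has_fps_expansion W"
    unfolding W_def by (rule holomorphic_has_fps_expansion_0[OF wh])
  have W0: "fps_nth W 0 = 0"
    by (simp add: W_def fps_expansion_def w0)
  have P: "psi_AP has_fps_expansion P"
    unfolding P_def by (rule holomorphic_has_fps_expansion_0[OF psi_AP_holomorphic])
  have D: "deriv f has_fps_expansion fps_deriv A"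
    by (rule has_fps_expansion_deriv[OF A])
  have "continuous_on unit_disc (deriv f)"
    by (intro holomorphic_on_imp_continuous_on holomorphic_deriv fh) auto
  then have "isCont (deriv f) 0"
    by (simp add: continuous_on_eq_continuous_at)
  then have "(deriv f \<longlongrightarrow> 1) (nhds 0)"
    by (simp add: isCont_def flip: tendsto_at_iff_tendsto_nhds f0)
  then have "\<forall>\<^sub>F z in nhds 0. deriv f z \<noteq> 0"
    by (rule tendsto_imp_eventually_ne) simp
  moreover have "\<forall>\<^sub>F z in nhds 0. z \<in> unit_disc"
    by (intro eventually_nhds_in_open) auto
  ultimately have ev: "\<forall>\<^sub>F z in nhds 0. deriv f z * (psi_AP \<circ> w) z = deriv f z + z * deriv (deriv f) z"
  proof eventually_elim
    case (elim z)
    then show ?case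
      by (simp flip: eq add: field_simps)
  qed
  have "(\<lambda>z. deriv f z * (psi_AP \<circ> w) z) has_fps_expansion fps_deriv A * (P oo W)"
    by (intro has_fps_expansion_mult has_fps_expansion_compose D P W W0)
  then have "(\<lambda>z. deriv f z + z * deriv (deriv f) z) has_fps_expansion fps_deriv A * (P oo W)"
    by (rule has_fps_expansion_cong[THEN iffD1, OF ev refl])
  moreover have "(\<lambda>z. deriv f z + z * deriv (deriv f) z) has_fps_expansion
                   fps_deriv A + fps_X * fps_deriv (fps_deriv A)"
    by (intro fps_expansion_intros D)
  ultimately have E: "fps_deriv A * (P oo W) = fps_deriv A + fps_X * fps_deriv (fps_deriv A)"
    by (rule fps_expansion_unique_complex)
  have P0: "fps_nth P 0 = 1"
    by (simp add: P_def fps_nth_psi_AP)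
  have PW: "fps_nth (P oo W) 0 = 1" "fps_nth (P oo W) (Suc 0) = 3 / 2 * fps_nth W (Suc 0)"
      "fps_nth (P oo W) 2 = 3 / 2 * fps_nth W 2 + 7 / 8 * (fps_nth W (Suc 0))\<^sup>2"
    using W0
    by (simp_all add: fps_compose_nth P_def eval_nat_numeral fps_mult_nth algebra_simps
        fps_nth_psi_AP(1,2) fps_nth_psi_AP(3)[unfolded numeral_2_eq_2])
  have "fps_nth (fps_deriv A * (P oo W)) (Suc 0)
          = fps_nth (fps_deriv A + fps_X * fps_deriv (fps_deriv A)) (Suc 0)"
    by (simp only: E)
  then have a2: "fps_nth A 2 = 3 / 4 * fps_nth W (Suc 0)"
    by (simp add: fps_mult_nth PW P0 A1 eval_nat_numeral)
  then show "taylor_coeff f 2 = 3 / 4 * fps_nth W (Suc 0)"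
    by (simp add: A_def)
  have "fps_nth (fps_deriv A * (P oo W)) 2
          = fps_nth (fps_deriv A + fps_X * fps_deriv (fps_deriv A)) 2"
    by (simp only: E)
  then have "fps_nth A 3 = 25 / 48 * (fps_nth W (Suc 0))\<^sup>2 + 1 / 4 * fps_nth W 2"
    by (simp add: fps_mult_nth eval_nat_numeral P0 A1
        PW(1,2) PW(3)[unfolded numeral_2_eq_2] a2[unfolded numeral_2_eq_2]) (simp add: field_simps)
  then show "taylor_coeff f 3 = 25 / 48 * (fps_nth W (Suc 0))\<^sup>2 + 1 / 4 * fps_nth W 2"
    by (simp add: A_def)
qed

text \<open>
The equation says that the logarithmic derivative of \<open>f'\<close> is \<open>q(z) = (\<psi>(w(z)) - 1) / z\<close>, which
is holomorphic in the disc because \<open>\<psi>(w(0)) = 1\<close>. So one takes \<open>f' = exp L\<close>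
for the primitive \<open>L\<close> of \<open>q\<close> with \<open>L(0) = 0\<close>, and for \<open>f\<close> the primitive of \<open>exp L\<close> with
\<open>f(0) = 0\<close>.
\<close>
lemma class_C_AP_from_schwarz_function:
  assumes w: "schwarz_function w"
  obtains f where "f \<in> class_C_AP"
    and "\<And>z. z \<in> unit_disc \<Longrightarrow> 1 + z * deriv (deriv f) z / deriv f z = psi_AP (w z)"
proof -
  define p where "p = (\<lambda>z. psi_AP (w z))"
  have wh: "w holomorphic_on unit_disc" and w0: "w 0 = 0" and wd: "w ` unit_disc \<subseteq> unit_disc"
    using w by (auto simp: schwarz_function_def)
  have ph: "p holomorphic_on unit_disc"
    using holomorphic_on_compose_gen[OF wh psi_AP_holomorphic wd] by (simp add: p_def o_def)
  have p0: "p 0 = 1"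
    by (simp add: p_def w0 psi_AP_def)
  obtain q where q: "q holomorphic_on unit_disc"
      and pq: "\<And>z. cmod z < 1 \<Longrightarrow> p z - 1 = z * q z"
  proof (rule Schwarz3)
    show "(\<lambda>z. p z - 1) holomorphic_on unit_disc"
      by (intro holomorphic_intros ph)
  qed (use p0 in auto)
  obtain L where L: "\<And>z. z \<in> unit_disc \<Longrightarrow> (L has_field_derivative q z) (at z within unit_disc)"
    using holomorphic_convex_primitive'[OF convex_ball open_ball q] by blast
  define h where "h = (\<lambda>z. exp (L z - L 0))"
  have L': "(L has_field_derivative q z) (at z)" if "z \<in> unit_disc" for z
    using L[OF that] that by (simp add: at_within_open[of _ unit_disc])
  have h': "(h has_field_derivative q z * h z) (at z)" if "z \<in> unit_disc" for z
    unfolding h_def by (auto intro!: derivative_eq_intros L' that)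
  then have hh: "h holomorphic_on unit_disc"
    using holomorphic_on_open by blast
  obtain F where F: "\<And>z. z \<in> unit_disc \<Longrightarrow> (F has_field_derivative h z) (at z within unit_disc)"
    using holomorphic_convex_primitive'[OF convex_ball open_ball hh] by blast
  define f where "f = (\<lambda>z. F z - F 0)"
  have f': "(f has_field_derivative h z) (at z)" if "z \<in> unit_disc" for z
    using F[OF that] that unfolding f_def
    by (auto intro!: derivative_eq_intros simp: at_within_open[of _ unit_disc])
  then have fh: "f holomorphic_on unit_disc"
    using holomorphic_on_open by blast
  have df: "deriv f z = h z" if "z \<in> unit_disc" for z
    using f'[OF that] by (rule DERIV_imp_deriv)
  have ddf: "deriv (deriv f) z = q z * h z" if "z \<in> unit_disc" for z
  proof (rule DERIV_imp_deriv)
    show "(deriv f has_field_derivative q z * h z) (at z)"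
      using h'[OF that] open_ball that
      by (rule has_field_derivative_transform_within_open) (simp add: df)
  qed
  have eq: "1 + z * deriv (deriv f) z / deriv f z = psi_AP (w z)" if "z \<in> unit_disc" for z
  proof -
    have "h z \<noteq> 0" by (simp add: h_def)
    then have "1 + z * deriv (deriv f) z / deriv f z = 1 + z * q z"
      using df[OF that] ddf[OF that] by simp
    also have "\<dots> = p z"
      using pq[of z] that by (simp add: algebra_simps)
    finally show ?thesis by (simp add: p_def)
  qed
  have "f \<in> class_A"
    using fh df[of 0] by (simp add: class_A_def f_def h_def)
  moreover have "(\<lambda>z. 1 + z * deriv (deriv f) z / deriv f z) holomorphic_on unit_disc"
    using ph by (rule holomorphic_transform) (simp add: eq p_def)
  ultimately have "f \<in> class_C_AP"
    using w eq psi_AP_holomorphic by (auto simp: class_C_AP_def subordinate_def)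
  then show thesis
    using eq that by blast
qed

text \<open>
The Blaschke product \<open>z (x + u z) / (1 + x u z)\<close> is extremal in the Schwarz-Pick inequality. For
\<open>x = 1\<close> the second factor is constant, and the formula still gives the right coefficients.
\<close>
lemma schwarz_function_with_coeffs:
  fixes x :: real and u :: complex
  assumes x: "0 \<le> x" "x \<le> 1" and u: "cmod u = 1"
  obtains w where "schwarz_function w"
    and "fps_nth (fps_expansion w 0) (Suc 0) = of_real x"
    and "fps_nth (fps_expansion w 0) 2 = u * of_real (1 - x\<^sup>2)"
proof -
  define d where "d = (\<lambda>z. 1 + of_real x * u * z)"
  define g where "g = (\<lambda>z. (of_real x + u * z) / d z)"
  define w where "w = (\<lambda>z. z * g z)"
  have nz: "d z \<noteq> 0" if "cmod z < 1" for z
  proof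
    assume "d z = 0"
    then have "of_real x * u * z = - 1"
      by (simp add: d_def add_eq_0_iff)
    then have "cmod (of_real x * u * z) = 1" by simp
    then have "x * cmod z = 1"
      using x u by (simp add: norm_mult)
    moreover have "x * cmod z \<le> 1 * cmod z"
      using x by (intro mult_right_mono) auto
    ultimately show False using that by simp
  qed
  have gh: "g holomorphic_on ball 0 1"
    unfolding g_def using nz by (intro holomorphic_intros) (auto simp: d_def intro!: holomorphic_intros)
  have g1: "cmod (g z) \<le> 1" if "cmod z < 1" for z
  proof -
    define v where "v = u * z"
    have v: "cmod v < 1" using that u by (simp add: v_def norm_mult)
    have "(cmod (1 + of_real x * v))\<^sup>2 - (cmod (of_real x + v))\<^sup>2 = (1 - x\<^sup>2) * (1 - (cmod v)\<^sup>2)"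
      using cmod_one_minus_cnj_mult_diff[of "- of_real x" v] by (simp add: add.commute)
    moreover have "(1 - x\<^sup>2) * (1 - (cmod v)\<^sup>2) \<ge> 0"
      using x v by (intro mult_nonneg_nonneg) (auto simp: power_le_one_iff abs_square_le_1)
    ultimately have "(cmod (of_real x + v))\<^sup>2 \<le> (cmod (1 + of_real x * v))\<^sup>2"
      by linarith
    then have "cmod (of_real x + v) \<le> cmod (1 + of_real x * v)"
      by (rule power2_le_imp_le) simp
    then show ?thesis
      using nz[OF that] by (simp add: g_def d_def v_def norm_divide mult.assoc)
  qed
  have "cmod (w z) < 1" if "cmod z < 1" for z
    using mult_left_mono[OF g1[OF that], of "cmod z"] that by (simp add: w_def norm_mult)
  then have "schwarz_function w"
    unfolding schwarz_function_def using gh by (auto simp: w_def intro!: holomorphic_intros)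
  moreover have W: "fps_expansion w 0 = fps_X * fps_expansion g 0"
    unfolding w_def
    by (intro fps_expansion_eqI fps_expansion_intros holomorphic_has_fps_expansion_0 gh)
  have "fps_nth (fps_expansion w 0) (Suc 0) = of_real x"
    unfolding W by (simp add: fps_expansion_def g_def d_def)
  moreover have "deriv g 0 = u * of_real (1 - x\<^sup>2)"
    unfolding g_def d_def
    by (rule DERIV_imp_deriv) (auto intro!: derivative_eq_intros simp: power2_eq_square algebra_simps)
  then have "fps_nth (fps_expansion w 0) 2 = u * of_real (1 - x\<^sup>2)"
    unfolding W by (simp add: fps_expansion_def)
  ultimately show thesis using that by blast
qed

section \<open>The range of the functional\<close>

lemma fekete_szego_eq_schwarz_coeffs:
  assumes "f \<in> class_A" and "schwarz_function w"
    and "\<And>z. z \<in> unit_disc \<Longrightarrow> 1 + z * deriv (deriv f) z / deriv f z = psi_AP (w z)"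
  defines "W \<equiv> fps_expansion w 0"
  shows "fekete_szego l \<mu> f = cmod ((25 - 27 * l) / 48 * (fps_nth W (Suc 0))\<^sup>2 + fps_nth W 2 / 4)
           - 3 * \<mu> / 4 * cmod (fps_nth W (Suc 0))"
proof -
  have a: "taylor_coeff f 2 = 3 / 4 * fps_nth W (Suc 0)"
      "taylor_coeff f 3 = 25 / 48 * (fps_nth W (Suc 0))\<^sup>2 + 1 / 4 * fps_nth W 2"
    unfolding W_def by (rule taylor_coeffs_from_schwarz_function[OF assms(1-3)]; assumption)+
  have "taylor_coeff f 3 - l * (taylor_coeff f 2)\<^sup>2
          = (25 - 27 * l) / 48 * (fps_nth W (Suc 0))\<^sup>2 + fps_nth W 2 / 4"
    unfolding a by (simp add: power2_eq_square field_simps)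
  then show ?thesis
    unfolding fekete_szego_def by (simp add: a(1) norm_mult)
qed

text \<open>
Both quadratics are meant for \<open>T = \<bar>25 - 27 l\<bar>\<close> and \<open>x = \<bar>c\<^sub>1\<bar>\<close>; the middle terms carry the extreme
modulus \<open>1 - x\<^sup>2\<close> of \<open>c\<^sub>2\<close>.
\<close>
definition upper_quadratic :: "real \<Rightarrow> real \<Rightarrow> real \<Rightarrow> real" where
  "upper_quadratic T \<mu> x = T / 48 * x\<^sup>2 + (1 - x\<^sup>2) / 4 - 3 * \<mu> / 4 * x"

definition lower_quadratic :: "real \<Rightarrow> real \<Rightarrow> real \<Rightarrow> real" where
  "lower_quadratic T \<mu> x = T / 48 * x\<^sup>2 - (1 - x\<^sup>2) / 4 - 3 * \<mu> / 4 * x"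

lemma fekete_szego_bounds:
  fixes l :: complex
  assumes "f \<in> class_C_AP"
  defines "T \<equiv> cmod (25 - 27 * l)"
  obtains x where "0 \<le> x" "x \<le> 1"
    and "fekete_szego l \<mu> f \<le> upper_quadratic T \<mu> x"
    and "fekete_szego l \<mu> f \<ge> lower_quadratic T \<mu> x"
    and "fekete_szego l \<mu> f \<ge> - (3 * \<mu> / 4 * x)"
proof -
  obtain w where w: "schwarz_function w" and f: "f \<in> class_A"
      and eq: "\<And>z. z \<in> unit_disc \<Longrightarrow> 1 + z * deriv (deriv f) z / deriv f z = psi_AP (w z)"
    using assms(1) by (auto simp: class_C_AP_def subordinate_def)
  define c1 where "c1 = fps_nth (fps_expansion w 0) (Suc 0)"
  define c2 where "c2 = fps_nth (fps_expansion w 0) 2"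
  define B where "B = (25 - 27 * l) / 48 * c1\<^sup>2"
  have c: "cmod c1 \<le> 1" "cmod c2 \<le> 1 - (cmod c1)\<^sup>2"
    unfolding c1_def c2_def by (intro schwarz_function_coeffs w)+
  have F: "fekete_szego l \<mu> f = cmod (B + c2 / 4) - 3 * \<mu> / 4 * cmod c1"
    unfolding B_def c1_def c2_def by (rule fekete_szego_eq_schwarz_coeffs[OF f w eq])
  have B: "cmod B = T / 48 * (cmod c1)\<^sup>2"
    by (simp add: B_def T_def norm_mult norm_divide norm_power)
  show thesis
  proof (rule that[of "cmod c1"])
    show "fekete_szego l \<mu> f \<le> upper_quadratic T \<mu> (cmod c1)"
      using norm_triangle_ineq[of B "c2 / 4"] c(2) by (simp add: F B upper_quadratic_def norm_divide field_simps)
    show "fekete_szego l \<mu> f \<ge> lower_quadratic T \<mu> (cmod c1)"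
      using norm_diff_ineq[of B "c2 / 4"] c(2) by (simp add: F B lower_quadratic_def norm_divide field_simps)
    show "fekete_szego l \<mu> f \<ge> - (3 * \<mu> / 4 * cmod c1)"
      by (simp add: F)
  qed (use c in auto)
qed

text \<open>
The coefficient \<open>c\<^sub>2\<close> is taken of maximal modulus and in phase (\<open>s = 1\<close>) or in opposite phase
(\<open>s = -1\<close>) with \<open>25 - 27 l\<close>. In opposite phase the modulus is the difference of the two moduli
only as long as the first dominates, which is the side condition of the second part.
\<close>
lemma fekete_szego_bounds_attained:
  fixes l :: complex and x :: real
  assumes x: "0 \<le> x" "x \<le> 1"
  defines "T \<equiv> cmod (25 - 27 * l)"
  shows "\<exists>f\<in>class_C_AP. fekete_szego l \<mu> f = upper_quadratic T \<mu> x"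
    and "T / 48 * x\<^sup>2 \<ge> (1 - x\<^sup>2) / 4 \<Longrightarrow>
           \<exists>f\<in>class_C_AP. fekete_szego l \<mu> f = lower_quadratic T \<mu> x"
proof -
  \<comment> \<open>The phase of \<open>25 - 27 l\<close>; any unit will do when that number is zero.\<close>
  obtain u where u: "cmod u = 1" "25 - 27 * l = of_real T * u"
  proof (cases "25 - 27 * l = 0")
    case True
    then show ?thesis using that[of 1] by (simp add: T_def)
  next
    case False
    then show ?thesis
      using that[of "sgn (25 - 27 * l)"] by (simp add: T_def norm_sgn) (simp add: sgn_eq)
  qed
  have attained: "\<exists>f\<in>class_C_AP. fekete_szego l \<mu> f
          = \<bar>T / 48 * x\<^sup>2 + s * ((1 - x\<^sup>2) / 4)\<bar> - 3 * \<mu> / 4 * x" if s: "\<bar>s\<bar> = 1" for s :: real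
  proof -
    obtain w where w: "schwarz_function w"
        and c: "fps_nth (fps_expansion w 0) (Suc 0) = of_real x"
          "fps_nth (fps_expansion w 0) 2 = of_real s * u * of_real (1 - x\<^sup>2)"
      using schwarz_function_with_coeffs[OF x, of "of_real s * u"] u s
      by (auto simp: norm_mult)
    obtain f where f: "f \<in> class_C_AP"
        and eq: "\<And>z. z \<in> unit_disc \<Longrightarrow> 1 + z * deriv (deriv f) z / deriv f z = psi_AP (w z)"
      using class_C_AP_from_schwarz_function[OF w] by blast
    have "f \<in> class_A" using f by (simp add: class_C_AP_def)
    then have "fekete_szego l \<mu> f = cmod ((25 - 27 * l) / 48 * (of_real x)\<^sup>2
                 + of_real s * u * of_real (1 - x\<^sup>2) / 4) - 3 * \<mu> / 4 * cmod (of_real x)"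
      using fekete_szego_eq_schwarz_coeffs[OF _ w eq] by (simp only: c)
    also have "(25 - 27 * l) / 48 * (of_real x)\<^sup>2 + of_real s * u * of_real (1 - x\<^sup>2) / 4
                 = of_real (T / 48 * x\<^sup>2 + s * ((1 - x\<^sup>2) / 4)) * u"
      unfolding u(2) by (simp add: algebra_simps)
    finally show ?thesis
      using f x u(1) by (auto simp: norm_mult simp del: of_real_add of_real_mult of_real_diff)
  qed
  have "T / 48 * x\<^sup>2 \<ge> 0" "(1 - x\<^sup>2) / 4 \<ge> 0"
    using x by (auto simp: T_def power_le_one_iff abs_square_le_1)
  then show "\<exists>f\<in>class_C_AP. fekete_szego l \<mu> f = upper_quadratic T \<mu> x"
    using attained[of 1] by (simp add: upper_quadratic_def)
  show "\<exists>f\<in>class_C_AP. fekete_szego l \<mu> f = lower_quadratic T \<mu> x"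
    if "T / 48 * x\<^sup>2 \<ge> (1 - x\<^sup>2) / 4"
  proof -
    have "\<bar>T / 48 * x\<^sup>2 + - 1 * ((1 - x\<^sup>2) / 4)\<bar> = T / 48 * x\<^sup>2 - (1 - x\<^sup>2) / 4"
      using that by linarith
    then show ?thesis
      using attained[of "-1"] by (simp only: lower_quadratic_def abs_minus_cancel abs_one)
  qed
qed

section \<open>Optimisation over the unit interval\<close>

text \<open>
The upper quadratic is \<open>1/4 + x ((T - 12)/48 x - 3\<mu>/4)\<close>: when
\<open>T \<ge> 12 + 36 \<mu>\<close>, the second factor is increasing and nonnegative at \<open>1\<close>; otherwise it is
nonpositive on \<open>[0, 1]\<close>. The lower one is convex, and completing the square
shows its vertex \<open>18 \<mu> / (T + 12)\<close>.
\<close>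
lemma unit_interval_quadratics:
  fixes T \<mu> :: real
  assumes T: "T \<ge> 0" and mu: "\<mu> > 0"
  defines "up \<equiv> upper_quadratic T \<mu>" and "lo \<equiv> lower_quadratic T \<mu>"
  shows upper_quadratic_le_at_1: "0 \<le> x \<Longrightarrow> x \<le> 1 \<Longrightarrow> T \<ge> 12 + 36 * \<mu> \<Longrightarrow> up x \<le> up 1"
    and upper_quadratic_le_at_0: "0 \<le> x \<Longrightarrow> x \<le> 1 \<Longrightarrow> T < 12 + 36 * \<mu> \<Longrightarrow> up x \<le> up 0"
    and lower_quadratic_ge_at_1: "0 \<le> x \<Longrightarrow> x \<le> 1 \<Longrightarrow> \<mu> \<ge> T / 18 + 2 / 3 \<Longrightarrow> lo x \<ge> lo 1"
    and lower_quadratic_mono_from_vertex: "18 * \<mu> / (T + 12) \<le> x \<Longrightarrow> x \<le> y \<Longrightarrow> lo x \<le> lo y"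
    and lower_quadratic_ge_vertex_value: "lo x \<ge> - (1 / 4) - 27 * \<mu>\<^sup>2 / (4 * T + 48)"
    and lower_quadratic_at_vertex: "lo (18 * \<mu> / (T + 12)) = - (1 / 4) - 27 * \<mu>\<^sup>2 / (4 * T + 48)"
proof -
  have up: "up x = 1 / 4 + x * ((T - 12) / 48 * x - 3 * \<mu> / 4)" for x
    by (simp add: up_def upper_quadratic_def power2_eq_square field_simps)
  have lo: "lo x = - (1 / 4) - 27 * \<mu>\<^sup>2 / (4 * T + 48) + (T + 12) / 48 * (x - 18 * \<mu> / (T + 12))\<^sup>2" for x
    using T by (simp add: lo_def lower_quadratic_def power2_eq_square divide_simps) (simp add: algebra_simps)
  show "lo x \<ge> - (1 / 4) - 27 * \<mu>\<^sup>2 / (4 * T + 48)"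
    using T by (simp add: lo)
  show "lo (18 * \<mu> / (T + 12)) = - (1 / 4) - 27 * \<mu>\<^sup>2 / (4 * T + 48)"
    by (simp add: lo)
  show "up x \<le> up 1" if x: "0 \<le> x" "x \<le> 1" and *: "T \<ge> 12 + 36 * \<mu>"
  proof -
    have "(T - 12) / 48 * x \<le> (T - 12) / 48 * 1"
      using x * mu by (intro mult_left_mono) auto
    then have "x * ((T - 12) / 48 * x - 3 * \<mu> / 4) \<le> x * ((T - 12) / 48 - 3 * \<mu> / 4)"
      using x by (intro mult_left_mono) auto
    also have "\<dots> \<le> 1 * ((T - 12) / 48 - 3 * \<mu> / 4)"
      using x * by (intro mult_right_mono) (auto simp: field_simps)
    finally show ?thesis by (simp add: up)
  qed
  show "up x \<le> up 0" if x: "0 \<le> x" "x \<le> 1" and *: "T < 12 + 36 * \<mu>"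
  proof -
    have "(T - 12) / 48 * x \<le> 3 * \<mu> / 4 * x"
      using x * by (intro mult_right_mono) (auto simp: field_simps)
    also have "\<dots> \<le> 3 * \<mu> / 4 * 1"
      using x mu by (intro mult_left_mono) auto
    finally show ?thesis
      using x by (simp add: up mult_nonneg_nonpos)
  qed
  show "lo x \<ge> lo 1" if x: "0 \<le> x" "x \<le> 1" and *: "\<mu> \<ge> T / 18 + 2 / 3"
  proof -
    have "18 * \<mu> / (T + 12) \<ge> 1"
      using T * by (simp add: field_simps)
    then have "(1 - 18 * \<mu> / (T + 12))\<^sup>2 \<le> (x - 18 * \<mu> / (T + 12))\<^sup>2"
      using x by (subst abs_le_square_iff[symmetric]) auto
    then show ?thesis
      unfolding lo using T by (intro add_left_mono mult_left_mono) auto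
  qed
  show "lo x \<le> lo y" if "18 * \<mu> / (T + 12) \<le> x" "x \<le> y"
    unfolding lo using T that by (intro add_left_mono mult_left_mono power_mono) auto
qed

theorem theorem6p1:
  fixes l :: complex and \<mu> :: real
  assumes "\<mu> > 0"
  shows
    "(cmod (25 - 27 * l) \<ge> 12 + 36 * \<mu> \<longrightarrow>
        (\<forall>f\<in>class_C_AP. fekete_szego l \<mu> f \<le> 1 / 48 * cmod (25 - 27 * l) - 3 * \<mu> / 4) \<and>
        (\<exists>f\<in>class_C_AP. fekete_szego l \<mu> f = 1 / 48 * cmod (25 - 27 * l) - 3 * \<mu> / 4)) \<and>
     (cmod (25 - 27 * l) < 12 + 36 * \<mu> \<longrightarrow>
        (\<forall>f\<in>class_C_AP. fekete_szego l \<mu> f \<le> 1 / 4) \<and>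
        (\<exists>f\<in>class_C_AP. fekete_szego l \<mu> f = 1 / 4)) \<and>
     (\<mu> \<ge> 1 / 18 * cmod (25 - 27 * l) + 2 / 3 \<longrightarrow>
        (\<forall>f\<in>class_C_AP. fekete_szego l \<mu> f \<ge> 1 / 48 * cmod (25 - 27 * l) - 3 * \<mu> / 4) \<and>
        (\<exists>f\<in>class_C_AP. fekete_szego l \<mu> f = 1 / 48 * cmod (25 - 27 * l) - 3 * \<mu> / 4)) \<and>
     (\<mu>\<^sup>2 \<le> 1 / 27 * cmod (25 - 27 * l) + 4 / 9 \<longrightarrow>
        (\<forall>f\<in>class_C_AP. fekete_szego l \<mu> f \<ge>
            - (3 * \<mu> / 4) * sqrt (12 / (cmod (25 - 27 * l) + 12))) \<and>
        (\<exists>f\<in>class_C_AP. fekete_szego l \<mu> f =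
            - (3 * \<mu> / 4) * sqrt (12 / (cmod (25 - 27 * l) + 12)))) \<and>
     (\<not> \<mu> \<ge> 1 / 18 * cmod (25 - 27 * l) + 2 / 3 \<and>
      \<not> \<mu>\<^sup>2 \<le> 1 / 27 * cmod (25 - 27 * l) + 4 / 9 \<longrightarrow>
        (\<forall>f\<in>class_C_AP. fekete_szego l \<mu> f \<ge>
            - (1 / 4) - 27 * \<mu>\<^sup>2 / (4 * cmod (25 - 27 * l) + 48)) \<and>
        (\<exists>f\<in>class_C_AP. fekete_szego l \<mu> f =
            - (1 / 4) - 27 * \<mu>\<^sup>2 / (4 * cmod (25 - 27 * l) + 48)))"
proof -
  define T where "T = cmod (25 - 27 * l)"
  define up where "up = upper_quadratic T \<mu>"
  define lo where "lo = lower_quadratic T \<mu>"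
  define x0 where "x0 = sqrt (12 / (T + 12))"
  define v where "v = 18 * \<mu> / (T + 12)"
  have T: "T \<ge> 0" by (simp add: T_def)
  note up_le_1 = upper_quadratic_le_at_1[OF T assms, folded up_def]
    and up_le_0 = upper_quadratic_le_at_0[OF T assms, folded up_def]
    and lo_ge_1 = lower_quadratic_ge_at_1[OF T assms, folded lo_def]
    and lo_mono = lower_quadratic_mono_from_vertex[OF T assms, folded lo_def v_def]
    and lo_ge_vertex = lower_quadratic_ge_vertex_value[OF T assms, folded lo_def]
    and lo_vertex = lower_quadratic_at_vertex[OF T assms, folded lo_def v_def]
  have bounds: "\<exists>x. 0 \<le> x \<and> x \<le> 1 \<and> fekete_szego l \<mu> f \<le> up x
      \<and> fekete_szego l \<mu> f \<ge> lo x \<and> fekete_szego l \<mu> f \<ge> - (3 * \<mu> / 4 * x)"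
    if "f \<in> class_C_AP" for f
    using fekete_szego_bounds[OF that, of l \<mu>] unfolding up_def lo_def T_def by blast
  have up_attained: "\<exists>f\<in>class_C_AP. fekete_szego l \<mu> f = up x" if "0 \<le> x" "x \<le> 1" for x
    using fekete_szego_bounds_attained(1)[OF that, of l \<mu>] by (simp add: up_def T_def)
  have x0sq: "x0\<^sup>2 = 12 / (T + 12)" and x0: "0 \<le> x0" "x0 \<le> 1"
    using T by (auto simp: x0_def)
  \<comment> \<open>So \<open>x0\<close> is where the moduli of the two terms balance when \<open>c\<^sub>2\<close> is extreme.\<close>
  have sign: "T / 48 * x\<^sup>2 - (1 - x\<^sup>2) / 4 = (T + 12) / 48 * (x\<^sup>2 - x0\<^sup>2)" for x
    using T by (simp add: x0sq field_simps)
  have lo_attained: "\<exists>f\<in>class_C_AP. fekete_szego l \<mu> f = lo x" if "x0 \<le> x" "x \<le> 1" for x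
  proof -
    have "T / 48 * x\<^sup>2 - (1 - x\<^sup>2) / 4 \<ge> 0"
      unfolding sign using T x0 that by (intro mult_nonneg_nonneg) (auto intro: power_mono)
    then show ?thesis
      using fekete_szego_bounds_attained(2)[of x l \<mu>] x0 that by (simp add: lo_def T_def)
  qed
  have lo_x0: "lo x0 = - (3 * \<mu> / 4) * x0"
    using sign[of x0] by (simp add: lo_def lower_quadratic_def)
  have vsq: "v \<le> x0 \<longleftrightarrow> \<mu>\<^sup>2 \<le> T / 27 + 4 / 9"
  proof -
    have "v \<ge> 0" using T assms by (simp add: v_def)
    then have "v \<le> x0 \<longleftrightarrow> v\<^sup>2 \<le> x0\<^sup>2"
      using x0 by (simp add: abs_le_square_iff[symmetric])
    also have "\<dots> \<longleftrightarrow> 324 * \<mu>\<^sup>2 / (T + 12) \<le> 12"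
      unfolding x0sq v_def using T by (simp add: power2_eq_square divide_simps)
    also have "\<dots> \<longleftrightarrow> \<mu>\<^sup>2 \<le> T / 27 + 4 / 9"
      using T by (auto simp: field_simps)
    finally show ?thesis .
  qed
  have up1: "up 1 = T / 48 - 3 * \<mu> / 4" and lo1: "lo 1 = T / 48 - 3 * \<mu> / 4" and up0: "up 0 = 1 / 4"
    by (simp_all add: up_def lo_def upper_quadratic_def lower_quadratic_def)
  have 1: "\<forall>f\<in>class_C_AP. fekete_szego l \<mu> f \<le> up 1" if "T \<ge> 12 + 36 * \<mu>"
    using bounds up_le_1 that by (meson order_trans)
  have 2: "\<forall>f\<in>class_C_AP. fekete_szego l \<mu> f \<le> up 0" if "T < 12 + 36 * \<mu>"
    using bounds up_le_0 that by (meson order_trans)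
  have 3: "\<forall>f\<in>class_C_AP. fekete_szego l \<mu> f \<ge> lo 1" if "\<mu> \<ge> T / 18 + 2 / 3"
    using bounds lo_ge_1 that by (meson order_trans)
  have 4: "\<forall>f\<in>class_C_AP. fekete_szego l \<mu> f \<ge> lo x0" if "\<mu>\<^sup>2 \<le> T / 27 + 4 / 9"
  proof
    fix f assume "f \<in> class_C_AP"
    then obtain x where x: "0 \<le> x" "x \<le> 1" "fekete_szego l \<mu> f \<ge> lo x"
        "fekete_szego l \<mu> f \<ge> - (3 * \<mu> / 4 * x)"
      using bounds by blast
    \<comment> \<open>Left of \<open>x0\<close> the linear bound applies, right of it the quadratic, which increases there.\<close>
    show "fekete_szego l \<mu> f \<ge> lo x0"
    proof (cases "x \<le> x0")
      case True
      then have "3 * \<mu> / 4 * x \<le> 3 * \<mu> / 4 * x0"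
        using assms by (intro mult_left_mono) auto
      then show ?thesis using x(4) by (simp add: lo_x0)
    next
      case False
      have "lo x0 \<le> lo x"
        using False vsq that by (intro lo_mono) auto
      then show ?thesis using x(3) by simp
    qed
  qed
  have 5: "\<forall>f\<in>class_C_AP. fekete_szego l \<mu> f \<ge> - (1 / 4) - 27 * \<mu>\<^sup>2 / (4 * T + 48)"
    using bounds lo_ge_vertex by (meson order_trans)
  have 6: "\<exists>f\<in>class_C_AP. fekete_szego l \<mu> f = - (1 / 4) - 27 * \<mu>\<^sup>2 / (4 * T + 48)"
    if "\<not> \<mu> \<ge> T / 18 + 2 / 3" "\<not> \<mu>\<^sup>2 \<le> T / 27 + 4 / 9"
  proof -
    have "v \<le> 1" using that(1) T by (simp add: v_def field_simps)
    moreover have "x0 \<le> v" using that(2) vsq by simp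
    ultimately show ?thesis
      using lo_attained[of v] lo_vertex by simp
  qed
  show ?thesis
    unfolding T_def[symmetric] x0_def[symmetric] lo_x0[symmetric]
    using 1 2 3 4 5 6 up_attained[of 1] up_attained[of 0] lo_attained[of 1] lo_attained[of x0] x0
    by (simp add: up1 lo1 up0)
qed

end
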